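(* If $S$ is a null semigroup of size $p$, then its degree is $\mu(S)=\min\{n\in\mathbb N : \xi(n)\geq p\}$.
   Context: A null semigroup is a semigroup $S$ with $S^2=\{z\}$ for some $z\in S$. The degree $\mu(S)$ of a finite semigroup $S$ is the least $n\geq1$ such that $S$ embeds in the full transformation semigroup $\mathcal T_n$ of all self-maps of $\{1,\dots,n\}$. For $n\in\mathbb N$, $\xi(n)=\max\{t^{n-t}: t\in\{1,\dots,n\}\}$ (with $0^0=1$). *)

theory Defs
  imports Main "HOL-Library.FuncSet"
begin

definition semigroup_on :: "'a set \<Rightarrow> ('a \<Rightarrow> 'a \<Rightarrow> 'a) \<Rightarrow> bool" where
  "semigroup_on S mul \<longleftrightarrow>
     (\<forall>x\<in>S. \<forall>y\<in>S. mul x y \<in> S) \<and>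
     (\<forall>x\<in>S. \<forall>y\<in>S. \<forall>z\<in>S. mul (mul x y) z = mul x (mul y z))"

definition null_semigroup :: "'a set \<Rightarrow> ('a \<Rightarrow> 'a \<Rightarrow> 'a) \<Rightarrow> bool" where
  "null_semigroup S mul \<longleftrightarrow>
     semigroup_on S mul \<and> (\<exists>z\<in>S. {mul x y |x y. x \<in> S \<and> y \<in> S} = {z})"

definition semigroup_embedding ::
  "'a set \<Rightarrow> ('a \<Rightarrow> 'a \<Rightarrow> 'a) \<Rightarrow> 'b set \<Rightarrow> ('b \<Rightarrow> 'b \<Rightarrow> 'b) \<Rightarrow> ('a \<Rightarrow> 'b) \<Rightarrow> bool" where
  "semigroup_embedding S mul T mul' \<phi> \<longleftrightarrow>
     \<phi> \<in> S \<rightarrow> T \<and> inj_on \<phi> S \<and>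
     (\<forall>x\<in>S. \<forall>y\<in>S. \<phi> (mul x y) = mul' (\<phi> x) (\<phi> y))"

text \<open>
  A self-map of \<open>{1..n}\<close> is represented by its extensional function, so that equality
  in the full transformation semigroup is equality of maps on \<open>{1..n}\<close>.
\<close>

definition full_trans :: "nat \<Rightarrow> (nat \<Rightarrow> nat) set" where
  "full_trans n = {1..n} \<rightarrow>\<^sub>E {1..n}"

text \<open>Maps act on the right: the product of \<open>f\<close> and \<open>g\<close> is \<open>f\<close> followed by \<open>g\<close>.\<close>

definition full_trans_mult :: "nat \<Rightarrow> (nat \<Rightarrow> nat) \<Rightarrow> (nat \<Rightarrow> nat) \<Rightarrow> (nat \<Rightarrow> nat)" where
  "full_trans_mult n f g = compose {1..n} g f"

definition embeds_in_full_trans :: "'a set \<Rightarrow> ('a \<Rightarrow> 'a \<Rightarrow> 'a) \<Rightarrow> nat \<Rightarrow> bool" where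
  "embeds_in_full_trans S mul n \<longleftrightarrow>
     (\<exists>\<phi>. semigroup_embedding S mul (full_trans n) (full_trans_mult n) \<phi>)"

definition semigroup_degree :: "'a set \<Rightarrow> ('a \<Rightarrow> 'a \<Rightarrow> 'a) \<Rightarrow> nat" where
  "semigroup_degree S mul = (LEAST n. n \<ge> 1 \<and> embeds_in_full_trans S mul n)"

text \<open>Only meaningful for \<open>n \<ge> 1\<close>, where the maximum is over a nonempty finite set.\<close>

definition xi :: "nat \<Rightarrow> nat" where
  "xi n = Max {t ^ (n - t) |t. t \<in> {1..n}}"

lemma semigroup_on_full_trans: "semigroup_on (full_trans n) (full_trans_mult n)"
  unfolding semigroup_on_def full_trans_def full_trans_mult_def
  by (auto simp: compose_def fun_eq_iff PiE_iff extensional_def)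

text \<open>
  Both minima are attained: the degree by the right regular representation of \<open>S\<close>
  with an identity adjoined, the other one because \<open>xi (p + 1) \<ge> p\<close>.
\<close>

lemma embeds_in_full_trans_exists:
  assumes fin: "finite S" and sg: "semigroup_on S mul"
  shows "embeds_in_full_trans S mul (card S + 1)"
proof -
  let ?m = "card S"
  obtain e where e: "bij_betw e {1..?m} S"
    using finite_same_card_bij[OF finite_atLeastAtMost fin, of 1 ?m] by auto
  define d where "d = inv_into {1..?m} e"
  have ed: "e (d s) = s" "d s \<in> {1..?m}" if "s \<in> S" for s
    using e that unfolding d_def bij_betw_def
    by (auto simp: f_inv_into_f inv_into_into simp del: atLeastAtMost_iff)
  have eS: "e i \<in> S" if "i \<in> {1..?m}" for i
    using e that by (auto simp: bij_betw_def)
  have cl: "mul x y \<in> S" if "x \<in> S" "y \<in> S" for x y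
    using sg that by (auto simp: semigroup_on_def)
  have as: "mul (mul x y) z = mul x (mul y z)" if "x \<in> S" "y \<in> S" "z \<in> S" for x y z
    using sg that by (auto simp: semigroup_on_def)
  define \<phi> where "\<phi> s = (\<lambda>i\<in>{1..?m+1}. if i \<in> {1..?m} then d (mul (e i) s) else d s)" for s
  have phi: "\<phi> s i = d (mul (e i) s)" if "i \<in> {1..?m}" for s i
    using that by (simp add: \<phi>_def)
  have phi1: "\<phi> s (?m+1) = d s" for s
    by (simp add: \<phi>_def)
  have "\<phi> \<in> S \<rightarrow> full_trans (?m+1)"
    using ed(2) cl eS by (fastforce simp: \<phi>_def full_trans_def)
  moreover have "inj_on \<phi> S"
    by (rule inj_onI) (metis ed(1) phi1)
  moreover have "\<phi> (mul x y) = full_trans_mult (?m+1) (\<phi> x) (\<phi> y)"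
    if xy: "x \<in> S" "y \<in> S" for x y
  proof
    fix i
    consider "i \<in> {1..?m}" | "i = ?m+1" | "i \<notin> {1..?m+1}" by fastforce
    then show "\<phi> (mul x y) i = full_trans_mult (?m+1) (\<phi> x) (\<phi> y) i"
    proof cases
      case 1
      then have "full_trans_mult (?m+1) (\<phi> x) (\<phi> y) i = \<phi> y (d (mul (e i) x))"
        by (simp add: full_trans_mult_def compose_eq phi)
      also have "\<dots> = d (mul (mul (e i) x) y)"
        using phi[OF ed(2)] ed(1) cl eS 1 xy by simp
      finally show ?thesis using phi[OF 1] as eS[OF 1] xy by simp
    next
      case 2
      then have "full_trans_mult (?m+1) (\<phi> x) (\<phi> y) i = \<phi> y (d x)"
        unfolding full_trans_mult_def by (simp add: compose_eq phi1[simplified])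
      also have "\<dots> = d (mul x y)" using phi[OF ed(2)] ed(1) xy by simp
      finally show ?thesis using 2 phi1 by simp
    next
      case 3
      then show ?thesis
        by (simp only: full_trans_mult_def compose_def \<phi>_def restrict_def if_False)
    qed
  qed
  ultimately show ?thesis
    unfolding embeds_in_full_trans_def semigroup_embedding_def by blast
qed

lemma xi_unbounded: "p \<le> xi (p + 1)"
proof (cases "p = 0")
  case False
  then have "p ^ (p + 1 - p) \<in> {t ^ (p + 1 - t) |t. t \<in> {1..p + 1}}"
    by (intro CollectI exI[of _ p]) simp
  then have "p ^ (p + 1 - p) \<le> xi (p + 1)"
    unfolding xi_def by (intro Max_ge) auto
  then show ?thesis by simp
qed simp

end

theory Submission
  imports Defs
begin

text \<open>
  Let \<open>N\<close> be a null semigroup of self-maps of \<open>{1..n}\<close> with zero \<open>z\<close>, and let \<open>Y\<close> be the union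
  of the images of its elements. For \<open>y = f x\<close> in \<open>Y\<close>, every \<open>g\<close> in \<open>N\<close> has
  \<open>g y = z x\<close>, so all elements of \<open>N\<close> agree on \<open>Y\<close>. They are therefore determined by their
  restrictions to the complement of \<open>Y\<close>, with values in \<open>Y\<close>, and there are at most
  \<open>t ^ (n - t)\<close> of these, where \<open>t = card Y\<close>. Conversely, the \<open>t ^ (n - t)\<close> maps with image
  in \<open>{1..t}\<close> that send \<open>{1..t}\<close> to \<open>1\<close> form a null semigroup.
\<close>

lemma null_semigroupE:
  assumes "null_semigroup S mul"
  obtains z where "z \<in> S" "\<And>x y. x \<in> S \<Longrightarrow> y \<in> S \<Longrightarrow> mul x y = z"
  using assms unfolding null_semigroup_def by blast

text \<open>A maximum over a nonempty finite set reaches \<open>p\<close> iff some member does. This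
  turns bounds on \<open>xi n\<close> into the choice of one \<open>t\<close>.\<close>

lemma le_xi_iff:
  assumes "n \<ge> 1"
  shows "p \<le> xi n \<longleftrightarrow> (\<exists>t\<in>{1..n}. p \<le> t ^ (n - t))"
proof -
  have "{t ^ (n - t) |t. t \<in> {1..n}} = (\<lambda>t. t ^ (n - t)) ` {1..n}"
    by blast
  with assms show ?thesis
    by (simp add: xi_def Max_ge_iff del: atLeastAtMost_iff)
qed

lemma null_semigroup_card_le_xi:
  assumes null: "null_semigroup S mul" and n: "n \<ge> 1"
    and emb: "embeds_in_full_trans S mul n"
  shows "card S \<le> xi n"
proof -
  obtain z where z: "z \<in> S" and mul: "\<And>x y. x \<in> S \<Longrightarrow> y \<in> S \<Longrightarrow> mul x y = z"
    using null by (rule null_semigroupE) blast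
  obtain \<phi> where maps: "\<And>s. s \<in> S \<Longrightarrow> \<phi> s \<in> {1..n} \<rightarrow>\<^sub>E {1..n}" and inj: "inj_on \<phi> S"
    and hom: "\<And>x y. x \<in> S \<Longrightarrow> y \<in> S \<Longrightarrow> \<phi> (mul x y) = compose {1..n} (\<phi> y) (\<phi> x)"
    using emb unfolding embeds_in_full_trans_def semigroup_embedding_def full_trans_def
      full_trans_mult_def by blast
  define Y where "Y = (\<Union>s\<in>S. \<phi> s ` {1..n})"
  have Y: "Y \<subseteq> {1..n}"
    using maps by (fastforce simp: Y_def)
  then have finY: "finite Y"
    by (rule finite_subset) simp
  have "Y \<noteq> {}"
    using z n by (auto simp: Y_def)
  with finY have "card Y \<ge> 1"
    by (simp add: Suc_le_eq card_gt_0_iff)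
  moreover have "card Y \<le> n"
    using card_mono[OF _ Y] by simp
  ultimately have t: "card Y \<in> {1..n}"
    by simp
  have agree: "\<phi> r y = \<phi> s y" if "r \<in> S" "s \<in> S" "y \<in> Y" for r s y
  proof -
    obtain u x where u: "u \<in> S" "x \<in> {1..n}" "y = \<phi> u x"
      using \<open>y \<in> Y\<close> by (auto simp: Y_def)
    \<comment> \<open>Here \<open>\<phi> v (\<phi> u x)\<close> is the image of \<open>x\<close>
      under \<open>\<phi> (mul u v) = \<phi> z\<close>, so \<open>v\<close> drops out.\<close>
    have "\<phi> v y = \<phi> z x" if "v \<in> S" for v
      using hom[OF \<open>u \<in> S\<close> that] mul[OF \<open>u \<in> S\<close> that] u by (simp add: compose_eq)
    with that show ?thesis
      by simp
  qed
  let ?X = "{1..n} - Y"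
  \<comment> \<open>By \<open>agree\<close>, distinct elements can differ only off
    \<open>Y\<close>.\<close>
  have "inj_on (\<lambda>s. restrict (\<phi> s) ?X) S"
  proof (rule inj_onI)
    fix r s
    assume rs: "r \<in> S" "s \<in> S" and eq: "restrict (\<phi> r) ?X = restrict (\<phi> s) ?X"
    have "\<phi> r x = \<phi> s x" if "x \<in> {1..n}" for x
    proof (cases "x \<in> Y")
      case True
      with agree rs show ?thesis by blast
    next
      case False
      with that fun_cong[OF eq, of x] show ?thesis by simp
    qed
    with maps rs have "\<phi> r = \<phi> s"
      by (metis PiE_ext)
    with inj rs show "r = s"
      by (simp add: inj_on_eq_iff)
  qed
  moreover have "(\<lambda>s. restrict (\<phi> s) ?X) ` S \<subseteq> ?X \<rightarrow>\<^sub>E Y"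
    unfolding image_subset_iff restrict_PiE_iff Y_def by blast
  moreover have "finite (?X \<rightarrow>\<^sub>E Y)"
    using finY by (intro finite_PiE) auto
  ultimately have "card S \<le> card (?X \<rightarrow>\<^sub>E Y)"
    by (rule card_inj_on_le)
  also have "\<dots> = card Y ^ (n - card Y)"
    using Y finY by (simp add: card_funcsetE card_Diff_subset)
  finally show ?thesis
    using t n by (auto simp: le_xi_iff simp del: atLeastAtMost_iff)
qed

lemma null_semigroup_embeds_in_full_trans:
  assumes null: "null_semigroup S mul" and fin: "finite S"
    and t: "t \<in> {1..n}" and card: "card S \<le> t ^ (n - t)"
  shows "embeds_in_full_trans S mul n"
proof -
  obtain z where z: "z \<in> S" and mul: "\<And>x y. x \<in> S \<Longrightarrow> y \<in> S \<Longrightarrow> mul x y = z"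
    using null by (rule null_semigroupE) blast
  define F where "F = {t<..n} \<rightarrow>\<^sub>E {1..t}"
  \<comment> \<open>All products will be the constant map 1, so \<open>z\<close> has to be coded by
    \<open>c\<close>.\<close>
  define c where "c = (\<lambda>i\<in>{t<..n}. 1::nat)"
  have finF: "finite F"
    by (auto simp: F_def intro: finite_PiE)
  have cF: "c \<in> F"
    using t by (auto simp: F_def c_def)
  have "card F = t ^ (n - t)"
    by (simp add: F_def card_funcsetE)
  \<comment> \<open>Setting \<open>z\<close> and \<open>c\<close> aside leaves room for an injection
    \<open>h\<close> of the rest, which \<open>k\<close> extends by sending \<open>z\<close> to
    \<open>c\<close>.\<close>
  with card z cF fin finF have "card (S - {z}) \<le> card (F - {c})"
    by simp
  then obtain h where h: "h ` (S - {z}) \<subseteq> F - {c}" "inj_on h (S - {z})"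
    using card_le_inj[of "S - {z}" "F - {c}"] fin finF by auto
  define k where "k = h(z := c)"
  have kF: "k s \<in> F" if "s \<in> S" for s
    using that h cF by (auto simp: k_def)
  have k_inj: "inj_on k S"
    using h by (auto simp: k_def inj_on_def image_subset_iff)
  have kz: "k z = c"
    by (simp add: k_def)
  define \<phi> where "\<phi> s = (\<lambda>i\<in>{1..n}. if i \<le> t then 1 else k s i)" for s
  have range: "\<phi> s i \<in> {1..t}" if "s \<in> S" "i \<in> {1..n}" for s i
    using kF[OF that(1)] that t by (auto simp: \<phi>_def F_def PiE_iff)
  have "\<phi> \<in> S \<rightarrow> full_trans n"
  proof
    fix s assume "s \<in> S"
    with range[of s] t show "\<phi> s \<in> full_trans n"
      unfolding full_trans_def by (fastforce simp: PiE_iff \<phi>_def)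
  qed
  moreover have "inj_on \<phi> S"
  proof (rule inj_onI)
    fix r s
    assume rs: "r \<in> S" "s \<in> S" and eq: "\<phi> r = \<phi> s"
    have "k r i = k s i" if "i \<in> {t<..n}" for i
      using fun_cong[OF eq, of i] that by (simp add: \<phi>_def)
    with kF rs have "k r = k s"
      unfolding F_def by (metis PiE_ext)
    with k_inj rs show "r = s"
      by (simp add: inj_on_eq_iff)
  qed
  moreover have "\<phi> (mul x y) = full_trans_mult n (\<phi> x) (\<phi> y)" if xy: "x \<in> S" "y \<in> S" for x y
  proof
    fix i
    show "\<phi> (mul x y) i = full_trans_mult n (\<phi> x) (\<phi> y) i"
    proof (cases "i \<in> {1..n}")
      case True
      \<comment> \<open>The inner value lies in \<open>{1..t}\<close>, which \<open>\<phi> y\<close>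
        collapses to 1.\<close>
      then have "\<phi> y (\<phi> x i) = 1"
        using range[OF xy(1) True] t by (simp add: \<phi>_def[of y])
      with True mul[OF xy] show ?thesis
        by (simp add: full_trans_mult_def compose_eq \<phi>_def[of z] kz c_def)
    next
      case False
      \<comment> \<open>Off \<open>{1..n}\<close> both sides are \<open>undefined\<close>.\<close>
      then show ?thesis
        by (simp only: full_trans_mult_def compose_def \<phi>_def restrict_def if_False)
    qed
  qed
  ultimately show ?thesis
    unfolding embeds_in_full_trans_def semigroup_embedding_def by blast
qed

theorem theorem4p7:
  fixes S :: "'a set" and mul :: "'a \<Rightarrow> 'a \<Rightarrow> 'a" and p :: nat
  assumes "null_semigroup S mul" and "finite S" and "card S = p"
  shows "semigroup_degree S mul = (LEAST n. n \<ge> 1 \<and> xi n \<ge> p)"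
proof -
  \<comment> \<open>The conditions under the two \<open>LEAST\<close> operators agree at every
    \<open>n\<close>, so the minima coincide.\<close>
  have "embeds_in_full_trans S mul n \<longleftrightarrow> p \<le> xi n" if "n \<ge> 1" for n
    using null_semigroup_card_le_xi[OF assms(1) that]
      null_semigroup_embeds_in_full_trans[OF assms(1,2)] le_xi_iff[OF that] assms(3)
    by blast
  then show ?thesis
    unfolding semigroup_degree_def by (metis (lifting))
qed

end
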